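(* Let $\{k,\bar k\}=\{1,2\}$, $g_k>g_{\bar k}>0$, $\hat P>0$, $\bar R_k,\bar R_{\bar k}>0$, and $\lambda,\delta,\mu\ge0$. Consider the problem of minimizing $$\bar{\mathcal L}(p_k,p_{\bar k})=\bar R_kX_k+\bar R_{\bar k}X_{\bar k}+\lambda(p_k+p_{\bar k})+\delta X_k+\mu X_{\bar k}$$ subject to $p_k\ge0$, $p_{\bar k}\ge0$, $p_k+p_{\bar k}\le\hat P$, where $X_k,X_{\bar k}\in\{0,1\}$ are the NOMA outage indicators (functions of $(p_k,p_{\bar k})$) defined in the context. Define $$\begin{aligned} &p_{1,k}=0,&&p_{1,\bar k}=0,\\ &p_{2,k}=\tfrac{2^{\bar R_k}-1}{g_k},&&p_{2,\bar k}=0,\\ &p_{3,k}=0,&&p_{3,\bar k}=\tfrac{2^{\bar R_{\bar k}}-1}{g_{\bar k}},\\ &p_{4,k}=\tfrac{2^{\bar R_k}-1}{g_k},&&p_{4,\bar k}=\big(2^{\bar R_{\bar k}}-1\big)\Big(\tfrac{2^{\bar R_k}-1}{g_k}+\tfrac1{g_{\bar k}}\Big). \end{aligned}$$ Then an optimal solution $(p_k^\ast,p_{\bar k}^\ast)$ is given by a pair $(p_{i,k},p_{i,\bar k})$ that minimizes $\bar{\mathcal L}(p_{i,k},p_{i,\bar k})$ among those $i\in\{1,2,3,4\}$ with $0\le p_{i,k}+p_{i,\bar k}\le\hat P$.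
   Context: Fix a fading state with normalized channel gains $g_k>g_{\bar k}$ and target rates $\bar R_k,\bar R_{\bar k}$. Let $$R_{k\to\bar k}=\log_2\Big(1+\frac{p_{\bar k}g_k}{p_kg_k+1}\Big),\quad R_{k\to k}=\log_2\Big(1+\frac{p_kg_k}{p_{\bar k}g_k+1}\Big),\quad R_k=\log_2(1+p_kg_k),\quad R_{\bar k\to\bar k}=\log_2\Big(1+\frac{p_{\bar k}g_{\bar k}}{p_kg_{\bar k}+1}\Big).$$ The outage indicator of the stronger user $k$ is $X_k=1$ if either ($R_{k\to\bar k}<\bar R_{\bar k}$ and $R_{k\to k}<\bar R_k$) or ($R_{k\to\bar k}\ge\bar R_{\bar k}$ and $R_k<\bar R_k$), and $X_k=0$ otherwise. The outage indicator of the weaker user $\bar k$ is $X_{\bar k}=1$ if $R_{\bar k\to\bar k}<\bar R_{\bar k}$, and $X_{\bar k}=0$ otherwise. *)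

theory Defs
  imports Complex_Main
begin

text \<open>
  Users are indexed by natural numbers, \<open>k\<close> being the stronger user and \<open>kb\<close> (for ``k bar'') the
  weaker one; \<open>g\<close> and \<open>R\<close> give the normalized channel gains and the target rates.
  A power allocation is the pair \<open>(p\<^sub>k, p\<^sub>k\<^sub>b)\<close>, the stronger user's power first.
\<close>

definition rate_strong_weak :: "(nat \<Rightarrow> real) \<Rightarrow> nat \<Rightarrow> real \<Rightarrow> real \<Rightarrow> real" where
  "rate_strong_weak g k pk pkb = log 2 (1 + pkb * g k / (pk * g k + 1))"

definition rate_strong_strong :: "(nat \<Rightarrow> real) \<Rightarrow> nat \<Rightarrow> real \<Rightarrow> real \<Rightarrow> real" where
  "rate_strong_strong g k pk pkb = log 2 (1 + pk * g k / (pkb * g k + 1))"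

definition rate_strong_sic :: "(nat \<Rightarrow> real) \<Rightarrow> nat \<Rightarrow> real \<Rightarrow> real" where
  "rate_strong_sic g k pk = log 2 (1 + pk * g k)"

definition rate_weak_weak :: "(nat \<Rightarrow> real) \<Rightarrow> nat \<Rightarrow> real \<Rightarrow> real \<Rightarrow> real" where
  "rate_weak_weak g kb pk pkb = log 2 (1 + pkb * g kb / (pk * g kb + 1))"

definition outage_strong ::
    "(nat \<Rightarrow> real) \<Rightarrow> (nat \<Rightarrow> real) \<Rightarrow> nat \<Rightarrow> nat \<Rightarrow> real \<Rightarrow> real \<Rightarrow> real" where
  "outage_strong g R k kb pk pkb =
     (if (rate_strong_weak g k pk pkb < R kb \<and> rate_strong_strong g k pk pkb < R k)
       \<or> (rate_strong_weak g k pk pkb \<ge> R kb \<and> rate_strong_sic g k pk < R k)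
      then 1 else 0)"

definition outage_weak ::
    "(nat \<Rightarrow> real) \<Rightarrow> (nat \<Rightarrow> real) \<Rightarrow> nat \<Rightarrow> real \<Rightarrow> real \<Rightarrow> real" where
  "outage_weak g R kb pk pkb = (if rate_weak_weak g kb pk pkb < R kb then 1 else 0)"

definition noma_lagrangian ::
    "(nat \<Rightarrow> real) \<Rightarrow> (nat \<Rightarrow> real) \<Rightarrow> nat \<Rightarrow> nat \<Rightarrow> real \<Rightarrow> real \<Rightarrow> real \<Rightarrow> real \<times> real \<Rightarrow> real" where
  "noma_lagrangian g R k kb lam \<delta> \<mu> = (\<lambda>(pk, pkb).
     R k * outage_strong g R k kb pk pkb + R kb * outage_weak g R kb pk pkb
     + lam * (pk + pkb)
     + \<delta> * outage_strong g R k kb pk pkb + \<mu> * outage_weak g R kb pk pkb)"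

definition feasible_powers :: "real \<Rightarrow> (real \<times> real) set" where
  "feasible_powers P = {(pk, pkb). pk \<ge> 0 \<and> pkb \<ge> 0 \<and> pk + pkb \<le> P}"

text \<open>Only the indices 1, 2, 3, 4 are meaningful; the final branch is the fourth pair.\<close>

definition candidate ::
    "(nat \<Rightarrow> real) \<Rightarrow> (nat \<Rightarrow> real) \<Rightarrow> nat \<Rightarrow> nat \<Rightarrow> nat \<Rightarrow> real \<times> real" where
  "candidate g R k kb i =
     (if i = 1 then (0, 0)
      else if i = 2 then ((2 powr R k - 1) / g k, 0)
      else if i = 3 then (0, (2 powr R kb - 1) / g kb)
      else ((2 powr R k - 1) / g k,
            (2 powr R kb - 1) * ((2 powr R k - 1) / g k + 1 / g kb)))"

definition feasible_index ::
    "(nat \<Rightarrow> real) \<Rightarrow> (nat \<Rightarrow> real) \<Rightarrow> nat \<Rightarrow> nat \<Rightarrow> real \<Rightarrow> nat \<Rightarrow> bool" where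
  "feasible_index g R k kb P i \<longleftrightarrow> i \<in> {1, 2, 3, 4} \<and>
     0 \<le> fst (candidate g R k kb i) + snd (candidate g R k kb i) \<and>
     fst (candidate g R k kb i) + snd (candidate g R k kb i) \<le> P"

end

theory Submission
  imports Defs
begin

text \<open>
  Every allocation is dominated by the candidate with the same outage pattern. If the stronger user
  is served, then \<open>p\<^sub>k g\<^sub>k \<ge> 2 powr R\<^sub>k - 1\<close>, whether or not it cancels the interference; if the weaker
  user is served, then \<open>p\<^sub>k\<^sub>b \<ge> (2 powr R\<^sub>k\<^sub>b - 1) (p\<^sub>k + 1 / g\<^sub>k\<^sub>b)\<close>. The candidates meet the relevant
  bounds with equality, so they use the least total power for their pattern.
\<close>

section \<open>Outage conditions without logarithms\<close>

lemma log2_one_plus_less_iff: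
  fixes u v r :: real
  assumes "u \<ge> 0" and "v > 0"
  shows "log 2 (1 + u / v) < r \<longleftrightarrow> u < (2 powr r - 1) * v"
proof -
  have "1 + u / v > 0"
    using assms by (simp add: add_pos_nonneg)
  then have "log 2 (1 + u / v) < r \<longleftrightarrow> 1 + u / v < 2 powr r"
    by (simp add: log_less_iff)
  also have "\<dots> \<longleftrightarrow> u / v < 2 powr r - 1"
    by linarith
  also have "\<dots> \<longleftrightarrow> u < (2 powr r - 1) * v"
    using assms(2) by (rule pos_divide_less_eq)
  finally show ?thesis .
qed

text \<open>Clearing the positive denominators turns every rate threshold into a polynomial
  inequality in the powers, so logarithms disappear from the rest of the argument.\<close>

lemma outage_strong_eq:
  assumes "g k > 0" and "x \<ge> 0" and "y \<ge> 0"
  shows "outage_strong g R k kb x y =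
    (if (y * g k < (2 powr R kb - 1) * (x * g k + 1) \<and> x * g k < (2 powr R k - 1) * (y * g k + 1))
      \<or> (y * g k \<ge> (2 powr R kb - 1) * (x * g k + 1) \<and> x * g k < 2 powr R k - 1) then 1 else 0)"
proof -
  have pos: "x * g k \<ge> 0" "y * g k \<ge> 0" "x * g k + 1 > 0" "y * g k + 1 > 0"
    using assms by (simp_all add: add_nonneg_pos)
  have "rate_strong_weak g k x y < R kb \<longleftrightarrow> y * g k < (2 powr R kb - 1) * (x * g k + 1)"
    unfolding rate_strong_weak_def by (rule log2_one_plus_less_iff) (use pos in auto)
  moreover have "rate_strong_strong g k x y < R k \<longleftrightarrow> x * g k < (2 powr R k - 1) * (y * g k + 1)"
    unfolding rate_strong_strong_def by (rule log2_one_plus_less_iff) (use pos in auto)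
  moreover have "rate_strong_sic g k x < R k \<longleftrightarrow> x * g k < 2 powr R k - 1"
    using log2_one_plus_less_iff[of "x * g k" 1] pos by (simp add: rate_strong_sic_def)
  ultimately show ?thesis
    unfolding outage_strong_def not_less[symmetric] by simp
qed

lemma outage_weak_eq:
  assumes "g kb > 0" and "x \<ge> 0" and "y \<ge> 0"
  shows "outage_weak g R kb x y =
    (if y * g kb < (2 powr R kb - 1) * (x * g kb + 1) then 1 else 0)"
proof -
  have "rate_weak_weak g kb x y < R kb \<longleftrightarrow> y * g kb < (2 powr R kb - 1) * (x * g kb + 1)"
    unfolding rate_weak_weak_def
    by (rule log2_one_plus_less_iff) (use assms in \<open>simp_all add: add_nonneg_pos\<close>)
  then show ?thesis
    by (simp add: outage_weak_def)
qed

section \<open>Minimal powers for serving a user\<close>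

context
  fixes k kb :: nat and g R :: "nat \<Rightarrow> real"
  assumes gains: "g k > g kb" "g kb > 0"
    and targets: "R k > 0" "R kb > 0"
begin

private lemma gain_strong_pos: "g k > 0"
  using gains by linarith

private lemma sinr_pos: "2 powr R k - 1 > 0" "2 powr R kb - 1 > 0"
  using targets by (simp_all add: gr_one_powr)

lemma candidate_nonneg: "fst (candidate g R k kb i) \<ge> 0" "snd (candidate g R k kb i) \<ge> 0"
  using gains gain_strong_pos sinr_pos by (auto simp: candidate_def)

text \<open>\<open>feasible_index\<close> constrains only the total power; since both coordinates of
  a candidate are nonnegative, this already places it in the feasible region.\<close>

lemma feasible_index_iff:
  "feasible_index g R k kb P i \<longleftrightarrow> i \<in> {1, 2, 3, 4} \<and> candidate g R k kb i \<in> feasible_powers P"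
  using candidate_nonneg[of i] by (auto simp: feasible_index_def feasible_powers_def split_beta)

lemma strong_served_power:
  assumes "x \<ge> 0" and "y \<ge> 0" and "outage_strong g R k kb x y = 0"
  shows "x \<ge> (2 powr R k - 1) / g k"
proof -
  \<comment> \<open>Treating interference as noise demands at least as much as decoding after
    cancellation, so the smaller threshold is met whichever way the user is served.\<close>
  have "(2 powr R k - 1) * 1 \<le> (2 powr R k - 1) * (y * g k + 1)"
    using sinr_pos gain_strong_pos assms(2) by (intro mult_left_mono) auto
  then have "x * g k \<ge> 2 powr R k - 1"
    using assms gain_strong_pos by (auto simp: outage_strong_eq split: if_splits)
  then show ?thesis
    using gain_strong_pos by (simp add: pos_divide_le_eq)
qed

lemma weak_served_power:
  assumes "x \<ge> 0" and "y \<ge> 0" and "outage_weak g R kb x y = 0"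
  shows "y \<ge> (2 powr R kb - 1) * (x + 1 / g kb)"
proof -
  have "(2 powr R kb - 1) * (x + 1 / g kb) * g kb = (2 powr R kb - 1) * (x * g kb + 1)"
    using gains(2) by (simp add: field_simps)
  also have "\<dots> \<le> y * g kb"
    using assms gains(2) by (simp add: outage_weak_eq split: if_splits)
  finally show ?thesis
    using gains(2) by simp
qed

section \<open>Outage patterns of the candidates\<close>

lemma outage_strong_without_power:
  assumes "y \<ge> 0"
  shows "outage_strong g R k kb 0 y = 1"
proof -
  \<comment> \<open>Zero power misses the threshold with interference as noise; after cancellation
    it misses \<open>2 powr R k - 1 > 0\<close>.\<close>
  have "0 < (2 powr R k - 1) * (y * g k + 1)"
    using sinr_pos gain_strong_pos assms by (simp add: add_nonneg_pos)
  then show ?thesis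
    using assms gain_strong_pos sinr_pos by (auto simp: outage_strong_eq)
qed

lemma outage_weak_without_power:
  assumes "x \<ge> 0"
  shows "outage_weak g R kb x 0 = 1"
proof -
  have "0 < (2 powr R kb - 1) * (x * g kb + 1)"
    using sinr_pos gains assms by (simp add: add_nonneg_pos)
  then show ?thesis
    using assms gains by (simp add: outage_weak_eq)
qed

text \<open>Without interference both thresholds for the user's own signal equal
  \<open>2 powr R k - 1\<close>. It is attained exactly, and outage requires a strict
  shortfall.\<close>

lemma outage_strong_candidate_2: "outage_strong g R k kb ((2 powr R k - 1) / g k) 0 = 0"
  using gain_strong_pos sinr_pos by (simp add: outage_strong_eq)

lemma outage_weak_candidate_3: "outage_weak g R kb 0 ((2 powr R kb - 1) / g kb) = 0"
  using gains sinr_pos by (simp add: outage_weak_eq)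

text \<open>The weaker user's power is calibrated to its own gain. The larger gain lets the stronger
  user decode that signal too and cancel it, after which its own power meets the target
  exactly.\<close>

lemma outage_strong_candidate_4:
  "outage_strong g R k kb ((2 powr R k - 1) / g k)
     ((2 powr R kb - 1) * ((2 powr R k - 1) / g k + 1 / g kb)) = 0"
proof -
  define a where "a = 2 powr R k - 1"
  define b where "b = 2 powr R kb - 1"
  have ab: "a > 0" "b > 0"
    using sinr_pos by (simp_all add: a_def b_def)
  have x: "a / g k * g k = a"
    using gain_strong_pos by simp
  \<comment> \<open>The gain order enters as \<open>1 \<le> g k / g kb\<close>; the left side is the
    decoding threshold \<open>b * (x * g k + 1)\<close> at \<open>x = a / g k\<close>.\<close>
  have "b * (a + 1) \<le> b * (a + g k / g kb)"
    using ab gains by (intro mult_left_mono) simp_all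
  also have "\<dots> = b * (a / g k + 1 / g kb) * g k"
    using gain_strong_pos gains by (simp add: field_simps)
  finally have "b * (a + 1) \<le> b * (a / g k + 1 / g kb) * g k" .
  moreover have "a / g k \<ge> 0" "b * (a / g k + 1 / g kb) \<ge> 0"
    using ab gain_strong_pos gains by simp_all
  ultimately show ?thesis
    using gain_strong_pos
    unfolding a_def[symmetric] b_def[symmetric]
    by (subst outage_strong_eq) (simp_all only: a_def[symmetric] b_def[symmetric] x, simp)
qed

lemma outage_weak_candidate_4:
  "outage_weak g R kb ((2 powr R k - 1) / g k)
     ((2 powr R kb - 1) * ((2 powr R k - 1) / g k + 1 / g kb)) = 0"
proof -
  define x where "x = (2 powr R k - 1) / g k"
  define b where "b = 2 powr R kb - 1"
  have "x \<ge> 0" "b > 0"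
    using sinr_pos gain_strong_pos by (simp_all add: x_def b_def)
  moreover from this have "b * (x + 1 / g kb) \<ge> 0"
    using gains by simp
  \<comment> \<open>The weaker user's power is chosen to give equality in its threshold, hence no
    outage.\<close>
  moreover have "b * (x + 1 / g kb) * g kb = b * (x * g kb + 1)"
    using gains by (simp add: field_simps)
  ultimately show ?thesis
    using gains unfolding x_def[symmetric] b_def[symmetric]
    by (subst outage_weak_eq) (simp_all only: b_def[symmetric], simp)
qed

section \<open>Domination by candidates and optimality\<close>

text \<open>Candidates 1 to 4 realize the patterns in which nobody, only the stronger user, only the
  weaker user, or both are served.\<close>

lemma candidate_same_outage_less_power:
  assumes "x \<ge> 0" and "y \<ge> 0"
  obtains i x' y' where "i \<in> {1, 2, 3, 4}" and "candidate g R k kb i = (x', y')"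
    and "x' + y' \<le> x + y"
    and "outage_strong g R k kb x' y' = outage_strong g R k kb x y"
    and "outage_weak g R kb x' y' = outage_weak g R kb x y"
proof -
  have S: "outage_strong g R k kb x y = 1 \<or> outage_strong g R k kb x y = 0"
    and W: "outage_weak g R kb x y = 1 \<or> outage_weak g R kb x y = 0"
    by (auto simp: outage_strong_def outage_weak_def)
  let ?a = "(2 powr R k - 1) / g k" and ?b = "2 powr R kb - 1"
  consider "outage_strong g R k kb x y = 1" "outage_weak g R kb x y = 1"
    | "outage_strong g R k kb x y = 0" "outage_weak g R kb x y = 1"
    | "outage_strong g R k kb x y = 1" "outage_weak g R kb x y = 0"
    | "outage_strong g R k kb x y = 0" "outage_weak g R kb x y = 0"
    using S W by blast
  then show thesis
  proof cases
    case 1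
    then show thesis
      using that[of 1 0 0] assms
      by (simp add: candidate_def outage_strong_without_power outage_weak_without_power)
  next
    case 2
    then show thesis
      using that[of 2 ?a 0] assms strong_served_power[OF assms] candidate_nonneg[of 2]
      by (simp add: candidate_def outage_strong_candidate_2 outage_weak_without_power)
  next
    case 3
    \<comment> \<open>Power of an unserved stronger user is mere interference: the bound on
      \<open>y\<close> grows with \<open>x\<close>, so it is least at \<open>x = 0\<close>.\<close>
    have "?b * (1 / g kb) \<le> ?b * (x + 1 / g kb)"
      using sinr_pos assms by (intro mult_left_mono) simp_all
    then show thesis
      using 3 that[of 3 0 "?b / g kb"] assms weak_served_power[OF assms] candidate_nonneg[of 3]
      by (simp add: candidate_def outage_strong_without_power outage_weak_candidate_3)
  next
    case 4
    have "?a \<le> x"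
      using strong_served_power[OF assms] 4 by simp
    \<comment> \<open>Lowering \<open>x\<close> to its minimum also lowers the bound on
      \<open>y\<close>, so both powers can be minimal at once.\<close>
    moreover from this have "?b * (?a + 1 / g kb) \<le> ?b * (x + 1 / g kb)"
      using sinr_pos by (intro mult_left_mono) simp_all
    moreover have "?b * (x + 1 / g kb) \<le> y"
      using weak_served_power[OF assms] 4 by simp
    ultimately have "?a + ?b * (?a + 1 / g kb) \<le> x + y"
      by linarith
    then show thesis
      using 4 that[of 4 ?a "?b * (?a + 1 / g kb)"]
      by (simp add: candidate_def outage_strong_candidate_4 outage_weak_candidate_4)
  qed
qed

text \<open>Equal indicators leave only the power term to compare, where \<open>lam \<ge> 0\<close>
  is used; the smaller total also keeps the candidate within the budget.\<close>

lemma candidate_dominates: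
  assumes "lam \<ge> 0" and "p \<in> feasible_powers P"
  obtains i where "feasible_index g R k kb P i"
    and "noma_lagrangian g R k kb lam \<delta> \<mu> (candidate g R k kb i)
         \<le> noma_lagrangian g R k kb lam \<delta> \<mu> p"
proof -
  obtain x y where p: "p = (x, y)" and xy: "x \<ge> 0" "y \<ge> 0" "x + y \<le> P"
    using assms(2) by (auto simp: feasible_powers_def)
  obtain i x' y' where i: "i \<in> {1, 2, 3, 4}" "candidate g R k kb i = (x', y')"
    and le: "x' + y' \<le> x + y"
    and same: "outage_strong g R k kb x' y' = outage_strong g R k kb x y"
      "outage_weak g R kb x' y' = outage_weak g R kb x y"
    using candidate_same_outage_less_power[OF xy(1,2)] by blast
  have "feasible_index g R k kb P i"
    using i le xy(3) candidate_nonneg[of i] by (simp add: feasible_index_iff feasible_powers_def)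
  moreover have "lam * (x' + y') \<le> lam * (x + y)"
    using le assms(1) by (rule mult_left_mono)
  ultimately show thesis
    using that[of i] by (simp add: p i same noma_lagrangian_def)
qed

end

theorem proposition4p1:
  fixes k kb :: nat and g R :: "nat \<Rightarrow> real" and P lam \<delta> \<mu> :: real
  assumes "{k, kb} = {1, 2}"
    and "g k > g kb" and "g kb > 0"
    and "P > 0"
    and "R k > 0" and "R kb > 0"
    and "lam \<ge> 0" and "\<delta> \<ge> 0" and "\<mu> \<ge> 0"
  shows "(\<exists>i. is_arg_min (\<lambda>i. noma_lagrangian g R k kb lam \<delta> \<mu> (candidate g R k kb i))
                (feasible_index g R k kb P) i) \<and>
         (\<forall>i. is_arg_min (\<lambda>i. noma_lagrangian g R k kb lam \<delta> \<mu> (candidate g R k kb i))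
                (feasible_index g R k kb P) i \<longrightarrow>
              is_arg_min (noma_lagrangian g R k kb lam \<delta> \<mu>)
                (\<lambda>p. p \<in> feasible_powers P) (candidate g R k kb i))"
proof -
  let ?L = "noma_lagrangian g R k kb lam \<delta> \<mu>" and ?c = "candidate g R k kb"
  let ?F = "feasible_index g R k kb P"
  have "finite (Collect ?F)"
    by (rule finite_subset[of _ "{1, 2, 3, 4}"]) (auto simp: feasible_index_def)
  \<comment> \<open>The zero allocation is within the budget, so the finite set of feasible indices
    is nonempty and a minimizer exists.\<close>
  moreover have "?F 1"
    using assms(4) by (simp add: feasible_index_def candidate_def)
  ultimately have "\<exists>i. is_arg_min (\<lambda>i. ?L (?c i)) ?F i"
    using ex_is_arg_min_if_finite[of "Collect ?F" "\<lambda>i. ?L (?c i)"] by auto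
  moreover have "is_arg_min ?L (\<lambda>p. p \<in> feasible_powers P) (?c i)"
    if "is_arg_min (\<lambda>i. ?L (?c i)) ?F i" for i
    unfolding is_arg_min_linorder
  proof (intro conjI allI impI)
    have F: "?F i" and min: "\<And>j. ?F j \<Longrightarrow> ?L (?c i) \<le> ?L (?c j)"
      using that by (auto simp: is_arg_min_linorder)
    show "?c i \<in> feasible_powers P"
      using F feasible_index_iff[OF assms(2,3,5,6)] by blast
    fix p
    assume "p \<in> feasible_powers P"
    \<comment> \<open>Any allocation is matched or beaten by a feasible candidate, which in turn is
      no better than the minimizing one.\<close>
    then obtain j where "?F j" "?L (?c j) \<le> ?L p"
      using candidate_dominates[OF assms(2,3,5,6,7)] by blast
    then show "?L (?c i) \<le> ?L p"
      using min[of j] by linarith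
  qed
  ultimately show ?thesis
    by blast
qed

end
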